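(* Let $\mathcal{A}$ be a central hyperplane arrangement in $\mathbb{C}^\ell$. For $k=3$ or $4$, $$|\mathrm{Ess}_k(\mathcal{A})|\le \frac{k^{\beta_{\mathbb{F}_k}(\mathcal{A})}-1}{(k-1)!}.$$ Moreover, the sets $\mathrm{Ess}_3(\mathcal{A})$ and $\mathrm{Ess}_4(\mathcal{A})$ cannot be simultaneously non-empty.
   Context: The arrangement $\mathcal{A}$ (a finite set of linear hyperplanes in $\mathbb{C}^\ell$) is viewed as a simple matroid, with dependence given by linear dependence of defining linear forms; $L_2(\mathcal{A})$ is the set of codimension-$2$ flats, a flat $X$ being identified with the set $\mathcal{A}_X$ of hyperplanes containing it, and $H\vee H'=H\cap H'$. The Orlik–Solomon algebra is $A(\mathcal{A})=E/(\partial e_S : S\text{ a circuit})$, with $E$ the exterior algebra over $\mathbb{Z}$ on degree-one generators $e_H$, $H\in\mathcal{A}$, $\partial$ the graded derivation of degree $-1$ with $\partial e_H=1$, $e_S=\prod_{H\in S}e_H$. For a field $K$, $A^1(\mathcal{A})\otimes K=K^{\mathcal{A}}$, $\sigma=\sum_H e_H$, $Z_K(\mathcal{A})=\{\tau\in K^{\mathcal{A}}\mid\sigma\tau=0\text{ in }A^2(\mathcal{A})\otimes K\}$, $B_K(\mathcal{A})=K\sigma$, and $\beta_K(\mathcal{A})=\dim_K Z_K(\mathcal{A})/B_K(\mathcal{A})$ (which depends only on the characteristic of $K$). The resonance variety $\mathcal{R}_1(\mathcal{A},\mathbb{C})\subseteq\mathbb{C}^{\mathcal{A}}$ is the set of $a\in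 A^1(\mathcal{A})\otimes\mathbb{C}$ for which the cochain complex $(A(\mathcal{A})\otimes\mathbb{C},\,b\mapsto ab)$ has non-zero cohomology in degree $1$. A $k$-multinet on $\mathcal{A}$ ($k\ge 3$) is a partition into $k$ non-empty classes $\mathcal{A}_\alpha$, with positive integer multiplicities $m_H$ and a base locus $\mathcal{X}\subseteq L_2(\mathcal{A})$ of flats of multiplicity $|\mathcal{A}_X|>2$, such that: (1) $\sum_{H\in\mathcal{A}_\alpha}m_H$ is independent of $\alpha$; (2) if $H,H'$ are in different classes, then $H\cap H'\in\mathcal{X}$; (3) for $X\in\mathcal{X}$, $n_X:=\sum_{H\in\mathcal{A}_\alpha\cap\mathcal{A}_X}m_H$ is independent of $\alpha$; (4) for $H,H'\in\mathcal{A}_\alpha$ there is a sequence $H=H_0,\dots,H_r=H'$ with $H_{i-1}\cap H_i\notin\mathcal{X}$ for all $i$. A $k$-net is a $k$-multinet with $n_X=1$ for all $X\in\mathcal{X}$ (hence all $m_H=1$). To a $k$-net $\mathcal{N}$ with classes $\mathcal{A}_1,\dots,\mathcal{A}_k$ corresponds the irreducible component of $\mathcal{R}_1(\mathcal{A},\mathbb{C})$ spanned by $u_2-u_1,\dots,u_k-u_1$, where $u_\alpha=\sum_{H\in\mathcal{A}_\alpha}e_H$. $\mathrm{Ess}_k(\mathcal{A})$ denotes the set of all irreducible components of $\mathcal{R}_1(\mathcal{A},\mathbb{C})$ which arise in this way from $k$-nets on $\mathcal{A}$. *)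

theory Defs
  imports "HOL-Analysis.Analysis" "HOL-Library.Poly_Mapping" "HOL-Library.Disjoint_Sets"
begin

section \<open>Arrangements and their matroids\<close>

definition ker_form :: "complex ^ 'n \<Rightarrow> (complex ^ 'n) set" where
  "ker_form c = {x. (\<Sum>i\<in>UNIV. c $ i * x $ i) = 0}"

definition central_arrangement :: "(complex ^ 'n) set set \<Rightarrow> bool" where
  "central_arrangement \<A> \<longleftrightarrow> finite \<A> \<and> (\<forall>H\<in>\<A>. \<exists>c. c \<noteq> 0 \<and> H = ker_form c)"

text \<open>A defining linear form is unique up to a nonzero scalar, so linear (in)dependence of
  such forms does not depend on the choice; distinct hyperplanes have distinct forms.\<close>

definition defining_form :: "(complex ^ 'n) set \<Rightarrow> complex ^ 'n" where
  "defining_form H = (SOME c. c \<noteq> 0 \<and> H = ker_form c)"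

definition dependent_hyperplanes :: "(complex ^ 'n) set set \<Rightarrow> bool" where
  "dependent_hyperplanes S \<longleftrightarrow> vec.dependent (defining_form ` S)"

definition circuit :: "(complex ^ 'n) set set \<Rightarrow> (complex ^ 'n) set set \<Rightarrow> bool" where
  "circuit \<A> S \<longleftrightarrow> S \<subseteq> \<A> \<and> dependent_hyperplanes S \<and> (\<forall>T. T \<subset> S \<longrightarrow> \<not> dependent_hyperplanes T)"

definition codim2_flats :: "(complex ^ 'n) set set \<Rightarrow> (complex ^ 'n) set set" where
  "codim2_flats \<A> = {\<Inter>\<B> | \<B>. \<B> \<subseteq> \<A> \<and> vec.dim (\<Inter>\<B>) + 2 = CARD('n)}"

definition hyperplanes_through :: "(complex ^ 'n) set set \<Rightarrow> (complex ^ 'n) set \<Rightarrow> (complex ^ 'n) set set" where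
  "hyperplanes_through \<A> X = {H \<in> \<A>. X \<subseteq> H}"

section \<open>The Orlik--Solomon algebra\<close>

text \<open>With concatenation as addition on words, the type \<open>'h list \<Rightarrow>\<^sub>0 'r\<close> carries the ring structure
  of the free associative \<open>'r\<close>-algebra on \<open>'h\<close>.\<close>

instantiation list :: (type) monoid_add
begin

definition zero_list :: "'a list" where "zero_list = []"

definition plus_list :: "'a list \<Rightarrow> 'a list \<Rightarrow> 'a list" where "plus_list xs ys = xs @ ys"

instance by standard (simp_all add: zero_list_def plus_list_def)

end

definition free_algebra :: "'h set \<Rightarrow> ('h list \<Rightarrow>\<^sub>0 'r::comm_ring_1) set" where
  "free_algebra \<A> = {p. Poly_Mapping.keys p \<subseteq> lists \<A>}"

definition monomial :: "'h list \<Rightarrow> ('h list \<Rightarrow>\<^sub>0 'r::comm_ring_1)" where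
  "monomial w = Poly_Mapping.single w 1"

text \<open>The derivation with \<open>\<partial> e\<^sub>H = 1\<close> for all \<open>H\<close>, on the word \<open>w\<close>.\<close>

definition boundary :: "'h list \<Rightarrow> ('h list \<Rightarrow>\<^sub>0 'r::comm_ring_1)" where
  "boundary w = (\<Sum>i<length w. Poly_Mapping.single (take i w @ drop (Suc i) w) ((-1) ^ i))"

text \<open>The exterior algebra is the free algebra modulo \<open>exterior_relations\<close>, and the Orlik--Solomon
  algebra with coefficients in \<open>'r\<close> is the free algebra modulo the ideal generated by both sets of
  relations. The product \<open>e\<^sub>S\<close> requires an ordering of \<open>S\<close> and all of them are
  allowed, as they give the same element up to sign modulo the exterior relations.\<close>

definition exterior_relations :: "'h set \<Rightarrow> ('h list \<Rightarrow>\<^sub>0 'r::comm_ring_1) set" where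
  "exterior_relations \<A> =
     {monomial [H] * monomial [H] | H. H \<in> \<A>} \<union>
     {monomial [H] * monomial [H'] + monomial [H'] * monomial [H] | H H'. H \<in> \<A> \<and> H' \<in> \<A>}"

definition circuit_relations :: "(complex ^ 'n) set set \<Rightarrow> ((complex ^ 'n) set list \<Rightarrow>\<^sub>0 'r::comm_ring_1) set" where
  "circuit_relations \<A> = {boundary w | w. distinct w \<and> circuit \<A> (set w)}"

inductive_set two_sided_ideal :: "'a::ring_1 set \<Rightarrow> 'a set \<Rightarrow> 'a set" for R G where
  zero: "0 \<in> two_sided_ideal R G"
| add: "x \<in> two_sided_ideal R G \<Longrightarrow> y \<in> two_sided_ideal R G \<Longrightarrow> x + y \<in> two_sided_ideal R G"
| gen: "g \<in> G \<Longrightarrow> p \<in> R \<Longrightarrow> q \<in> R \<Longrightarrow> p * g * q \<in> two_sided_ideal R G"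

definition os_ideal :: "(complex ^ 'n) set set \<Rightarrow> ((complex ^ 'n) set list \<Rightarrow>\<^sub>0 'r::comm_ring_1) set" where
  "os_ideal \<A> = two_sided_ideal (free_algebra \<A>) (exterior_relations \<A> \<union> circuit_relations \<A>)"

text \<open>\<open>K\<^sup>\<A>\<close>, as functions vanishing outside \<open>\<A>\<close>, and its identification with the degree-one part.\<close>

definition coord_space :: "'h set \<Rightarrow> ('h \<Rightarrow> 'r::zero) set" where
  "coord_space \<A> = {a. \<forall>H. H \<notin> \<A> \<longrightarrow> a H = 0}"

definition degree_one :: "'h set \<Rightarrow> ('h \<Rightarrow> 'r) \<Rightarrow> ('h list \<Rightarrow>\<^sub>0 'r::comm_ring_1)" where
  "degree_one \<A> a = (\<Sum>H\<in>\<A>. Poly_Mapping.single [H] (a H))"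

definition os_prod_zero :: "(complex ^ 'n) set set \<Rightarrow> ((complex ^ 'n) set \<Rightarrow> 'r::comm_ring_1) \<Rightarrow> ((complex ^ 'n) set \<Rightarrow> 'r) \<Rightarrow> bool" where
  "os_prod_zero \<A> a b \<longleftrightarrow> degree_one \<A> a * degree_one \<A> b \<in> os_ideal \<A>"

section \<open>Modular resonance: the numbers \<open>\<beta>\<^sub>K(\<A>)\<close>\<close>

definition sigma_elt :: "(complex ^ 'n) set set \<Rightarrow> (complex ^ 'n) set \<Rightarrow> 'f::field" where
  "sigma_elt \<A> = indicator \<A>"

definition Z_space :: "(complex ^ 'n) set set \<Rightarrow> ((complex ^ 'n) set \<Rightarrow> 'f::field) set" where
  "Z_space \<A> = {\<tau> \<in> coord_space \<A>. os_prod_zero \<A> (sigma_elt \<A>) \<tau>}"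

definition B_space :: "(complex ^ 'n) set set \<Rightarrow> ((complex ^ 'n) set \<Rightarrow> 'f::field) set" where
  "B_space \<A> = {(\<lambda>H. c * sigma_elt \<A> H) | c. True}"

text \<open>\<open>S\<close> represents a basis of the quotient space \<open>Z / B\<close>.\<close>

definition quotient_basis :: "('h \<Rightarrow> 'f::field) set \<Rightarrow> ('h \<Rightarrow> 'f) set \<Rightarrow> ('h \<Rightarrow> 'f) set \<Rightarrow> bool" where
  "quotient_basis Z B S \<longleftrightarrow> finite S \<and> S \<subseteq> Z \<and>
     (\<forall>c. (\<lambda>H. \<Sum>v\<in>S. c v * v H) \<in> B \<longrightarrow> (\<forall>v\<in>S. c v = 0)) \<and>
     (\<forall>z\<in>Z. \<exists>c. (\<lambda>H. z H - (\<Sum>v\<in>S. c v * v H)) \<in> B)"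

definition quotient_dim :: "('h \<Rightarrow> 'f::field) set \<Rightarrow> ('h \<Rightarrow> 'f) set \<Rightarrow> nat" where
  "quotient_dim Z B = (THE n. \<exists>S. quotient_basis Z B S \<and> card S = n)"

definition resonance_beta :: "'f::field itself \<Rightarrow> (complex ^ 'n) set set \<Rightarrow> nat" where
  "resonance_beta K \<A> = quotient_dim (Z_space \<A> :: ((complex ^ 'n) set \<Rightarrow> 'f) set) (B_space \<A>)"

section \<open>The resonance variety and its irreducible components\<close>

text \<open>A cocycle \<open>b\<close> in degree 1 is a coboundary iff it is a multiple of \<open>a\<close>, since the degree-0
  part is \<open>\<complex>\<close>.\<close>

definition resonance_variety :: "(complex ^ 'n) set set \<Rightarrow> ((complex ^ 'n) set \<Rightarrow> complex) set" where
  "resonance_variety \<A> = {a \<in> coord_space \<A>.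
     \<exists>b \<in> coord_space \<A>. os_prod_zero \<A> a b \<and> \<not> (\<exists>c. b = (\<lambda>H. c * a H))}"

inductive_set polynomial_maps :: "'h set \<Rightarrow> (('h \<Rightarrow> complex) \<Rightarrow> complex) set" for \<A> where
  const: "(\<lambda>_. c) \<in> polynomial_maps \<A>"
| coord: "H \<in> \<A> \<Longrightarrow> (\<lambda>a. a H) \<in> polynomial_maps \<A>"
| add: "f \<in> polynomial_maps \<A> \<Longrightarrow> g \<in> polynomial_maps \<A> \<Longrightarrow> (\<lambda>a. f a + g a) \<in> polynomial_maps \<A>"
| mult: "f \<in> polynomial_maps \<A> \<Longrightarrow> g \<in> polynomial_maps \<A> \<Longrightarrow> (\<lambda>a. f a * g a) \<in> polynomial_maps \<A>"

definition zariski :: "'h set \<Rightarrow> ('h \<Rightarrow> complex) topology" where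
  "zariski \<A> = topology_generated_by {{a \<in> coord_space \<A>. f a \<noteq> 0} | f. f \<in> polynomial_maps \<A>}"

definition irreducible_subset :: "'a topology \<Rightarrow> 'a set \<Rightarrow> bool" where
  "irreducible_subset T S \<longleftrightarrow> S \<subseteq> topspace T \<and> S \<noteq> {} \<and>
     (\<forall>F G. closedin T F \<and> closedin T G \<and> S \<subseteq> F \<union> G \<longrightarrow> S \<subseteq> F \<or> S \<subseteq> G)"

definition irreducible_components :: "'a topology \<Rightarrow> 'a set set" where
  "irreducible_components T =
     {S. irreducible_subset T S \<and> (\<forall>S'. irreducible_subset T S' \<and> S \<subseteq> S' \<longrightarrow> S' = S)}"

section \<open>Multinets, nets and essential components\<close>

definition multinet ::
  "(complex ^ 'n) set set \<Rightarrow> nat \<Rightarrow> (nat \<Rightarrow> (complex ^ 'n) set set) \<Rightarrow> ((complex ^ 'n) set \<Rightarrow> nat)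
    \<Rightarrow> (complex ^ 'n) set set \<Rightarrow> bool" where
  "multinet \<A> k cls m \<X> \<longleftrightarrow>
     k \<ge> 3 \<and>
     (\<Union>\<alpha>\<in>{1..k}. cls \<alpha>) = \<A> \<and> disjoint_family_on cls {1..k} \<and> (\<forall>\<alpha>\<in>{1..k}. cls \<alpha> \<noteq> {}) \<and>
     (\<forall>H\<in>\<A>. m H > 0) \<and>
     \<X> \<subseteq> codim2_flats \<A> \<and> (\<forall>X\<in>\<X>. card (hyperplanes_through \<A> X) > 2) \<and>
     (\<forall>\<alpha>\<in>{1..k}. \<forall>\<beta>\<in>{1..k}. (\<Sum>H\<in>cls \<alpha>. m H) = (\<Sum>H\<in>cls \<beta>. m H)) \<and>
     (\<forall>\<alpha>\<in>{1..k}. \<forall>\<beta>\<in>{1..k}. \<alpha> \<noteq> \<beta> \<longrightarrow> (\<forall>H\<in>cls \<alpha>. \<forall>H'\<in>cls \<beta>. H \<inter> H' \<in> \<X>)) \<and>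
     (\<forall>X\<in>\<X>. \<forall>\<alpha>\<in>{1..k}. \<forall>\<beta>\<in>{1..k}.
        (\<Sum>H\<in>cls \<alpha> \<inter> hyperplanes_through \<A> X. m H) = (\<Sum>H\<in>cls \<beta> \<inter> hyperplanes_through \<A> X. m H)) \<and>
     (\<forall>\<alpha>\<in>{1..k}. \<forall>H\<in>cls \<alpha>. \<forall>H'\<in>cls \<alpha>. \<exists>(r::nat) Hs. Hs 0 = H \<and> Hs r = H' \<and>
        (\<forall>i\<le>r. Hs i \<in> \<A>) \<and> (\<forall>i\<in>{1..r}. Hs (i - 1) \<inter> Hs i \<notin> \<X>))"

definition net :: "(complex ^ 'n) set set \<Rightarrow> nat \<Rightarrow> (nat \<Rightarrow> (complex ^ 'n) set set) \<Rightarrow> bool" where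
  "net \<A> k cls \<longleftrightarrow> (\<exists>m \<X>. multinet \<A> k cls m \<X> \<and>
     (\<forall>X\<in>\<X>. \<forall>\<alpha>\<in>{1..k}. (\<Sum>H\<in>cls \<alpha> \<inter> hyperplanes_through \<A> X. m H) = 1))"

text \<open>The span of \<open>u\<^sub>\<alpha> - u\<^sub>1\<close> for \<open>2 \<le> \<alpha> \<le> k\<close>, where \<open>u\<^sub>\<alpha>\<close> is the indicator function of the
  class \<open>\<alpha>\<close>.\<close>

definition net_component :: "nat \<Rightarrow> (nat \<Rightarrow> 'h set) \<Rightarrow> ('h \<Rightarrow> complex) set" where
  "net_component k cls =
     {(\<lambda>H. \<Sum>\<alpha>=2..k. c \<alpha> * (indicator (cls \<alpha>) H - indicator (cls 1) H)) | c. True}"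

definition Ess :: "nat \<Rightarrow> (complex ^ 'n) set set \<Rightarrow> ((complex ^ 'n) set \<Rightarrow> complex) set set" where
  "Ess k \<A> = {C \<in> irreducible_components (subtopology (zariski \<A>) (resonance_variety \<A>)).
     \<exists>cls. net \<A> k cls \<and> C = net_component k cls}"

end

theory Submission
  imports Defs
begin

text \<open>A \<open>k\<close>-net is a surjective colouring \<open>\<rho>\<close> of the arrangement by \<open>k\<close> colours for which the flat
  spanned by two hyperplanes of different colours contains every colour exactly once. Composing
  \<open>\<rho>\<close> with a bijection \<open>g\<close> onto the field with \<open>k\<close> elements gives \<open>\<tau>\<close> with \<open>\<sigma>\<tau> = 0\<close>: pairs of the
  same colour cancel by anticommutativity, and on a base flat the product is killed by the circuit
  relations because both \<open>k\<close> and the sum of all field elements vanish in the field.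
  The level sets of \<open>\<tau>\<close> recover the net up to relabelling, so the \<open>k!\<close> choices of \<open>g\<close> for each
  component are pairwise distinct nonconstant cocycles, of which there are \<open>k (k\<^sup>\<beta> - 1)\<close>.

  If there were both a 3-net and a 4-net, two hyperplanes would have the same colour in one of
  them, since they cannot span a flat of multiplicity both 3 and 4. But the union of
  two equivalence relations is the full relation only if one of them is.\<close>

section \<open>Counting in quotients of function spaces\<close>

text \<open>Closure is stated pointwise to match \<open>quotient_basis\<close>, where vectors are
  functions and combinations are pointwise sums.\<close>

definition function_subspace :: "('h \<Rightarrow> 'f::field) set \<Rightarrow> bool" where
  "function_subspace V \<longleftrightarrow> (\<lambda>_. 0) \<in> V \<and> (\<forall>x\<in>V. \<forall>y\<in>V. (\<lambda>H. x H + y H) \<in> V) \<and>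
     (\<forall>c. \<forall>x\<in>V. (\<lambda>H. c * x H) \<in> V)"

lemma function_subspace_add:
  "function_subspace V \<Longrightarrow> x \<in> V \<Longrightarrow> y \<in> V \<Longrightarrow> (\<lambda>H. x H + y H) \<in> V"
  by (simp add: function_subspace_def)

lemma function_subspace_scale:
  "function_subspace V \<Longrightarrow> x \<in> V \<Longrightarrow> (\<lambda>H. c * x H) \<in> V"
  by (simp add: function_subspace_def)

lemma function_subspace_diff:
  assumes "function_subspace V" "x \<in> V" "y \<in> V"
  shows "(\<lambda>H. x H - y H) \<in> V"
  using function_subspace_add[OF assms(1,2) function_subspace_scale[OF assms(1,3), of "-1"]]
  by simp

lemma function_subspace_sum:
  assumes "function_subspace V" "finite S" "S \<subseteq> V"
  shows "(\<lambda>H. \<Sum>v\<in>S. c v * v H) \<in> V"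
  using assms(2,3)
proof (induction S rule: finite_induct)
  case empty
  then show ?case using assms(1) by (simp add: function_subspace_def)
next
  case (insert x S)
  then show ?case
    using function_subspace_add[OF assms(1) function_subspace_scale[OF assms(1), of x "c x"]]
    by simp
qed

text \<open>Every element of \<open>Z\<close> is uniquely an element of \<open>B\<close> plus a
  combination of \<open>S\<close>. The coefficient functions are taken extensional on
  \<open>S\<close>, so that each combination has only one.\<close>

lemma card_quotient_basis:
  fixes Z B :: "('h \<Rightarrow> 'f::field) set"
  assumes Z: "function_subspace Z" and B: "function_subspace B" and "B \<subseteq> Z"
    and S: "quotient_basis Z B S"
  shows "card Z = card B * CARD('f) ^ card S"
proof -
  have fin: "finite S" and SZ: "S \<subseteq> Z"
    and indep: "\<And>c v. (\<lambda>H. \<Sum>v\<in>S. c v * v H) \<in> B \<Longrightarrow> v \<in> S \<Longrightarrow> c v = 0"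
    and span: "\<And>z. z \<in> Z \<Longrightarrow> \<exists>c. (\<lambda>H. z H - (\<Sum>v\<in>S. c v * v H)) \<in> B"
    using S unfolding quotient_basis_def by blast+
  let ?lin = "\<lambda>c H. \<Sum>v\<in>S. c v * v H"
  let ?\<phi> = "\<lambda>(b, c) H. b H + ?lin c H"
  have "bij_betw ?\<phi> (B \<times> (S \<rightarrow>\<^sub>E UNIV)) Z"
    unfolding bij_betw_def
  proof (intro conjI inj_onI subset_antisym subsetI)
    fix p q :: "('h \<Rightarrow> 'f) \<times> (('h \<Rightarrow> 'f) \<Rightarrow> 'f)"
    assume pq: "p \<in> B \<times> (S \<rightarrow>\<^sub>E UNIV)" "q \<in> B \<times> (S \<rightarrow>\<^sub>E UNIV)" "?\<phi> p = ?\<phi> q"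
    obtain b c b' c' where [simp]: "p = (b, c)" "q = (b', c')" by (cases p, cases q)
    have eq: "b H + ?lin c H = b' H + ?lin c' H" for H
      using pq(3) by (simp add: fun_eq_iff)
    \<comment> \<open>Equal images put a combination of \<open>S\<close> into \<open>B\<close>, and
      independence modulo \<open>B\<close> then forces equal coefficients.\<close>
    have "?lin (\<lambda>v. c v - c' v) H = b' H - b H" for H
      using eq[of H] by (simp add: left_diff_distrib sum_subtractf algebra_simps)
    then have "?lin (\<lambda>v. c v - c' v) \<in> B"
      using function_subspace_diff[OF B, of b' b] pq(1,2) by (simp add: fun_eq_iff)
    then have "c v = c' v" if "v \<in> S" for v using indep[of "\<lambda>v. c v - c' v" v] that by simp
    then have c: "c = c'" using pq(1,2) by (auto intro: PiE_ext)
    then have "b = b'" using eq by (auto simp: fun_eq_iff)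
    with c show "p = q" by simp
  next
    fix z assume "z \<in> ?\<phi> ` (B \<times> (S \<rightarrow>\<^sub>E UNIV))"
    then show "z \<in> Z"
      using \<open>B \<subseteq> Z\<close> by (auto intro!: function_subspace_add[OF Z] function_subspace_sum[OF Z fin SZ])
  next
    fix z assume "z \<in> Z"
    then obtain c where c: "(\<lambda>H. z H - ?lin c H) \<in> B" using span by blast
    \<comment> \<open>The \<open>c\<close> obtained from \<open>span\<close> is arbitrary off
      \<open>S\<close>; restricting it leaves the combination unchanged.\<close>
    have "?lin (restrict c S) = ?lin c" by (intro ext sum.cong) auto
    then have "?\<phi> ((\<lambda>H. z H - ?lin c H), restrict c S) = z" by (simp add: fun_eq_iff)
    moreover have "((\<lambda>H. z H - ?lin c H), restrict c S) \<in> B \<times> (S \<rightarrow>\<^sub>E UNIV)"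
      using c by auto
    ultimately show "z \<in> ?\<phi> ` (B \<times> (S \<rightarrow>\<^sub>E UNIV))" by (metis (no_types, lifting) imageI)
  qed
  then have "card Z = card (B \<times> (S \<rightarrow>\<^sub>E (UNIV :: 'f set)))"
    by (simp add: bij_betw_same_card)
  then show ?thesis
    by (simp add: card_cartesian_product card_PiE[OF fin])
qed

text \<open>A maximal subset of \<open>Z\<close> that is independent modulo \<open>B\<close> also
  spans: adjoining a further \<open>z\<close> creates a relation in which \<open>z\<close> has a
  nonzero coefficient, and the relation can be solved for \<open>z\<close>.\<close>

lemma quotient_basis_exists:
  fixes Z B :: "('h \<Rightarrow> 'f::field) set"
  assumes "finite Z" and B: "function_subspace B"
  shows "\<exists>S. quotient_basis Z B S"
proof -
  define indep where "indep S \<longleftrightarrow> (\<forall>c. (\<lambda>H. \<Sum>v\<in>S. c v * v H) \<in> B \<longrightarrow> (\<forall>v\<in>S. c v = 0))"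
    for S :: "('h \<Rightarrow> 'f) set"
  let ?\<S> = "{S. S \<subseteq> Z \<and> indep S}"
  have "finite ?\<S>" using \<open>finite Z\<close> by simp
  moreover have "{} \<in> ?\<S>" by (simp add: indep_def)
  ultimately obtain S where S: "S \<in> ?\<S>" and max: "\<And>T. T \<in> ?\<S> \<Longrightarrow> S \<subseteq> T \<Longrightarrow> S = T"
    using finite_has_maximal[of ?\<S>] by (metis (no_types, lifting) empty_iff)
  have fin: "finite S" using S \<open>finite Z\<close> finite_subset by blast
  have "\<exists>c. (\<lambda>H. z H - (\<Sum>v\<in>S. c v * v H)) \<in> B" if z: "z \<in> Z" for z
  proof (cases "z \<in> S")
    case True
    have "(\<Sum>v\<in>S. (if v = z then 1 else 0) * v H) = z H" for H
      using True fin by (simp add: if_distrib[of "\<lambda>x. x * _"] cong: if_cong)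
    then show ?thesis
      using B by (intro exI[of _ "\<lambda>v. if v = z then 1 else 0"]) (simp add: function_subspace_def)
  next
    case False
    then have "insert z S \<notin> ?\<S>" using max by blast
    then have "\<not> indep (insert z S)" using S z by blast
    then obtain c where c: "(\<lambda>H. \<Sum>v\<in>insert z S. c v * v H) \<in> B" "\<exists>v\<in>insert z S. c v \<noteq> 0"
      unfolding indep_def by blast
    have c': "(\<lambda>H. c z * z H + (\<Sum>v\<in>S. c v * v H)) \<in> B" using c(1) False fin by simp
    \<comment> \<open>Otherwise the relation would involve \<open>S\<close> alone and be
      trivial.\<close>
    have cz: "c z \<noteq> 0"
    proof
      assume "c z = 0"
      with c' have "(\<lambda>H. \<Sum>v\<in>S. c v * v H) \<in> B" by simp
      then have "\<forall>v\<in>S. c v = 0" using S by (auto simp: indep_def)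
      with c(2) \<open>c z = 0\<close> show False by auto
    qed
    have "(\<lambda>H. (1 / c z) * (c z * z H + (\<Sum>v\<in>S. c v * v H))) \<in> B"
      by (rule function_subspace_scale[OF B c'])
    also have "(\<lambda>H. (1 / c z) * (c z * z H + (\<Sum>v\<in>S. c v * v H))) =
        (\<lambda>H. z H - (\<Sum>v\<in>S. (- c v / c z) * v H))"
      using cz by (simp add: fun_eq_iff distrib_left sum_divide_distrib sum_negf)
    finally show ?thesis by (intro exI[of _ "\<lambda>v. - c v / c z"])
  qed
  moreover have "S \<subseteq> Z" "indep S" using S by auto
  ultimately have "quotient_basis Z B S"
    using fin unfolding quotient_basis_def indep_def by (intro conjI ballI) auto
  then show ?thesis ..
qed

text \<open>\<open>quotient_dim\<close> is a definite description, so all quotient bases must be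
  shown to have the same size. Counting does this: the size is an exponent of
  \<open>CARD('f) > 1\<close> determined by the cardinalities of \<open>Z\<close> and
  \<open>B\<close>.\<close>

lemma card_eq_power_quotient_dim:
  fixes Z B :: "('h \<Rightarrow> 'f::field) set"
  assumes "finite Z" "function_subspace Z" "function_subspace B" "B \<subseteq> Z" "CARD('f) > 1"
  shows "card Z = card B * CARD('f) ^ quotient_dim Z B"
proof -
  obtain S where S: "quotient_basis Z B S" using quotient_basis_exists assms by blast
  note card = card_quotient_basis[OF assms(2-4)]
  have "finite B" using assms finite_subset by blast
  then have "card B > 0" using assms(3) by (auto simp: card_gt_0_iff function_subspace_def)
  then have unique: "card T = card S" if "quotient_basis Z B T" for T
  proof -
    have "card B * CARD('f) ^ card T = card B * CARD('f) ^ card S"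
      using card[OF S] card[OF that] by metis
    with \<open>card B > 0\<close> show ?thesis using power_inject_exp[OF assms(5)] by simp
  qed
  then have "quotient_dim Z B = card S"
    unfolding quotient_dim_def using S unique by (intro the_equality) blast+
  then show ?thesis by (simp only: card[OF S])
qed

section \<open>The Orlik--Solomon ideal in degree two\<close>

lemma free_algebra_mult:
  assumes "p \<in> free_algebra A" "q \<in> free_algebra A"
  shows "p * q \<in> free_algebra A"
  using assms keys_mult[of p q] by (fastforce simp: free_algebra_def plus_list_def)

lemma single_in_free_algebra: "w \<in> lists A \<Longrightarrow> Poly_Mapping.single w c \<in> free_algebra A"
  by (simp add: free_algebra_def)

lemma one_in_free_algebra: "1 \<in> free_algebra A"
  by (simp add: free_algebra_def zero_list_def)

text \<open>The rule \<open>gen\<close> multiplies generators only; here the outer factors are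
  absorbed into the cofactors of each generator, which uses that \<open>R\<close> is closed under
  products.\<close>

lemma two_sided_ideal_mult:
  assumes "x \<in> two_sided_ideal R G" "p \<in> R" "q \<in> R"
    and "\<And>a b. a \<in> R \<Longrightarrow> b \<in> R \<Longrightarrow> a * b \<in> R"
  shows "p * x * q \<in> two_sided_ideal R G"
  using assms(1)
proof induction
  case zero
  then show ?case by (simp add: two_sided_ideal.zero)
next
  case (add x y)
  then show ?case by (simp add: distrib_left distrib_right two_sided_ideal.add)
next
  case (gen g p' q')
  then have "(p * p') * g * (q' * q) \<in> two_sided_ideal R G"
    using assms by (intro two_sided_ideal.gen) auto
  then show ?case by (simp add: mult.assoc)
qed

text \<open>The empty word is the unit of the word monoid, so
  \<open>Poly_Mapping.single [] c\<close> is the scalar \<open>c\<close>.\<close>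

lemma os_ideal_scale:
  assumes "x \<in> os_ideal \<A>"
  shows "Poly_Mapping.single [] c * x \<in> os_ideal \<A>"
proof -
  have "Poly_Mapping.single [] c * x * 1 \<in> os_ideal \<A>"
    using assms unfolding os_ideal_def
    by (intro two_sided_ideal_mult single_in_free_algebra one_in_free_algebra free_algebra_mult) auto
  then show ?thesis by simp
qed

lemma os_ideal_add: "x \<in> os_ideal \<A> \<Longrightarrow> y \<in> os_ideal \<A> \<Longrightarrow> x + y \<in> os_ideal \<A>"
  unfolding os_ideal_def by (rule two_sided_ideal.add)

lemma single_Nil_mult: "Poly_Mapping.single [] c * Poly_Mapping.single w d = Poly_Mapping.single w (c * d)"
  by (simp add: mult_single plus_list_def)

lemma os_ideal_uminus:
  fixes x :: "(complex ^ 'n) set list \<Rightarrow>\<^sub>0 'r::comm_ring_1"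
  assumes "x \<in> os_ideal \<A>"
  shows "- x \<in> os_ideal \<A>"
proof -
  have "(Poly_Mapping.single [] (-1) :: (complex ^ 'n) set list \<Rightarrow>\<^sub>0 'r) = - 1"
    by (metis single_uminus single_one zero_list_def)
  then show ?thesis using os_ideal_scale[OF assms, of "-1"] by simp
qed

lemma os_ideal_diff: "x \<in> os_ideal \<A> \<Longrightarrow> y \<in> os_ideal \<A> \<Longrightarrow> x - y \<in> os_ideal \<A>"
  using os_ideal_add[of x \<A> "- y"] os_ideal_uminus[of y \<A>] by simp

lemma os_ideal_sum: "(\<And>i. i \<in> I \<Longrightarrow> f i \<in> os_ideal \<A>) \<Longrightarrow> sum f I \<in> os_ideal \<A>"
proof (induction I rule: infinite_finite_induct)
  case (insert x F)
  then show ?case by (simp add: os_ideal_add)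
qed (simp_all add: os_ideal_def two_sided_ideal.zero)

lemma os_ideal_generator:
  assumes "g \<in> exterior_relations \<A> \<union> circuit_relations \<A>"
  shows "g \<in> os_ideal \<A>"
proof -
  have "1 * g * 1 \<in> os_ideal \<A>"
    unfolding os_ideal_def using assms by (intro two_sided_ideal.gen one_in_free_algebra)
  then show ?thesis by simp
qed

lemma os_ideal_square:
  assumes "H \<in> \<A>"
  shows "Poly_Mapping.single [H, H] c \<in> os_ideal \<A>"
proof -
  have "Poly_Mapping.single [] c * (monomial [H] * monomial [H]) \<in> os_ideal \<A>"
    using assms by (intro os_ideal_scale os_ideal_generator) (auto simp: exterior_relations_def)
  then show ?thesis by (simp add: monomial_def mult_single plus_list_def)
qed

lemma os_ideal_anticommute:
  assumes "H \<in> \<A>" "H' \<in> \<A>"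
  shows "Poly_Mapping.single [H, H'] c + Poly_Mapping.single [H', H] c \<in> os_ideal \<A>"
proof -
  have "Poly_Mapping.single [] c * (monomial [H] * monomial [H'] + monomial [H'] * monomial [H]) \<in> os_ideal \<A>"
    using assms by (intro os_ideal_scale os_ideal_generator) (auto simp: exterior_relations_def)
  then show ?thesis by (simp add: monomial_def mult_single plus_list_def distrib_left)
qed

text \<open>This is \<open>c\<close> times the boundary of a three-element circuit, the kind of
  circuit relation that has degree two.\<close>

lemma os_ideal_circuit3:
  fixes c :: "'r::comm_ring_1"
  assumes "distinct [H1, H2, H3]" "circuit \<A> {H1, H2, H3}"
  shows "Poly_Mapping.single [H2, H3] c - Poly_Mapping.single [H1, H3] c
    + Poly_Mapping.single [H1, H2] c \<in> os_ideal \<A>"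
proof -
  have rel: "(boundary [H1, H2, H3] :: _ \<Rightarrow>\<^sub>0 'r) \<in> circuit_relations \<A>"
    unfolding circuit_relations_def using assms by (intro CollectI exI[of _ "[H1, H2, H3]"]) simp
  have "Poly_Mapping.single [] c * boundary [H1, H2, H3] \<in> os_ideal \<A>"
    using rel by (intro os_ideal_scale os_ideal_generator UnI2)
  also have "boundary [H1, H2, H3] = Poly_Mapping.single [H2, H3] 1
      - Poly_Mapping.single [H1, H3] (1::'r) + Poly_Mapping.single [H1, H2] 1"
    by (simp add: boundary_def numeral_3_eq_3 lessThan_Suc single_uminus algebra_simps)
  finally show ?thesis by (simp add: distrib_left right_diff_distrib single_Nil_mult)
qed

text \<open>The sum is \<open>c\<close> times the square of the sum of the generators in
  \<open>S\<close>, which already vanishes in the exterior algebra. It serves both for the square of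
  \<open>sigma_elt\<close> and for pairs of equal colour.\<close>

lemma os_ideal_constant_block:
  assumes "finite S" "S \<subseteq> \<A>"
  shows "(\<Sum>H\<in>S. \<Sum>H'\<in>S. Poly_Mapping.single [H, H'] c) \<in> os_ideal \<A>"
  using assms
proof (induction S rule: finite_induct)
  case empty
  then show ?case by (simp add: os_ideal_def two_sided_ideal.zero)
next
  case (insert x S)
  have "(\<Sum>H\<in>insert x S. \<Sum>H'\<in>insert x S. Poly_Mapping.single [H, H'] c) =
      Poly_Mapping.single [x, x] c
      + (\<Sum>H\<in>S. Poly_Mapping.single [x, H] c + Poly_Mapping.single [H, x] c)
      + (\<Sum>H\<in>S. \<Sum>H'\<in>S. Poly_Mapping.single [H, H'] c)"
    using insert by (simp add: sum.distrib algebra_simps)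
  also have "\<dots> \<in> os_ideal \<A>"
  proof (intro os_ideal_add)
    show "(\<Sum>H\<in>S. \<Sum>H'\<in>S. Poly_Mapping.single [H, H'] c) \<in> os_ideal \<A>" using insert by simp
  qed (use insert in \<open>auto intro!: os_ideal_sum os_ideal_square os_ideal_anticommute\<close>)
  finally show ?case .
qed

lemma single_sum: "Poly_Mapping.single w (sum f S) = (\<Sum>i\<in>S. Poly_Mapping.single w (f i))"
  by (induction S rule: infinite_finite_induct) (auto simp: single_add)

text \<open>Fix \<open>H0\<close> in \<open>S\<close>. The circuit relations rewrite the product of
  H and H' as (H0 times H') minus (H0 times H). After summation the first part carries the factor
  \<open>card S\<close> and the second the factor \<open>sum \<tau> S\<close>, and both are
  zero.\<close>

lemma os_ideal_pencil:
  fixes \<tau> :: "(complex ^ 'n) set \<Rightarrow> 'r::comm_ring_1"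
  assumes "S \<subseteq> \<A>"
    and circuits: "\<And>H1 H2 H3. H1 \<in> S \<Longrightarrow> H2 \<in> S \<Longrightarrow> H3 \<in> S \<Longrightarrow> distinct [H1, H2, H3] \<Longrightarrow>
      circuit \<A> {H1, H2, H3}"
    and "of_nat (card S) = (0::'r)" "sum \<tau> S = 0"
  shows "(\<Sum>H\<in>S. \<Sum>H'\<in>S. Poly_Mapping.single [H, H'] (\<tau> H')) \<in> os_ideal \<A>"
proof (cases "S = {}")
  case True
  then show ?thesis by (simp add: os_ideal_def two_sided_ideal.zero)
next
  case False
  then obtain H0 where H0: "H0 \<in> S" by blast
  let ?s = "Poly_Mapping.single :: _ \<Rightarrow> 'r \<Rightarrow> _"
  \<comment> \<open>For three distinct hyperplanes this is the circuit relation; the degenerate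
    cases reduce to squares and anticommutators.\<close>
  have rel: "?s [H, H'] c - (?s [H0, H'] c - ?s [H0, H] c) \<in> os_ideal \<A>"
    if "H \<in> S" "H' \<in> S" for H H' c
  proof -
    have in_\<A>: "H0 \<in> \<A>" "H \<in> \<A>" "H' \<in> \<A>" using that H0 assms(1) by auto
    consider "H = H'" | "H \<noteq> H'" "H = H0" | "H \<noteq> H'" "H' = H0" | "distinct [H0, H, H']" by auto
    then show ?thesis
    proof cases
      case 1
      then show ?thesis using os_ideal_square in_\<A> by simp
    next
      case 2
      then show ?thesis using os_ideal_square in_\<A> by simp
    next
      case 3
      then have "?s [H, H'] c - (?s [H0, H'] c - ?s [H0, H] c) =
        (?s [H, H0] c + ?s [H0, H] c) - ?s [H0, H0] c" by simp
      also have "\<dots> \<in> os_ideal \<A>"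
        using in_\<A> by (intro os_ideal_diff os_ideal_anticommute os_ideal_square)
      finally show ?thesis .
    next
      case 4
      then show ?thesis
        using os_ideal_circuit3[OF 4 circuits[OF H0 that 4], of c] by (simp add: algebra_simps)
    qed
  qed
  have "(\<Sum>H\<in>S. \<Sum>H'\<in>S. ?s [H0, H'] (\<tau> H')) = (\<Sum>H'\<in>S. ?s [H0, H'] (of_nat (card S) * \<tau> H'))"
    by (subst sum.swap, intro sum.cong refl, subst single_sum[symmetric]) simp
  moreover have "(\<Sum>H\<in>S. \<Sum>H'\<in>S. ?s [H0, H] (\<tau> H')) = (\<Sum>H\<in>S. ?s [H0, H] (sum \<tau> S))"
    by (simp add: single_sum)
  \<comment> \<open>Both rewritten sums vanish outright, so subtracting them changes nothing and
    brings every summand into the form of \<open>rel\<close>.\<close>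
  ultimately have "(\<Sum>H\<in>S. \<Sum>H'\<in>S. ?s [H, H'] (\<tau> H')) =
      (\<Sum>H\<in>S. \<Sum>H'\<in>S. ?s [H, H'] (\<tau> H') - (?s [H0, H'] (\<tau> H') - ?s [H0, H] (\<tau> H')))"
    using assms(3,4) by (simp add: sum_subtractf)
  also have "\<dots> \<in> os_ideal \<A>" by (intro os_ideal_sum rel)
  finally show ?thesis .
qed

lemma degree_one_mult:
  "degree_one \<A> a * degree_one \<A> b =
    (\<Sum>H\<in>\<A>. \<Sum>H'\<in>\<A>. Poly_Mapping.single [H, H'] (a H * b H'))"
  by (simp add: degree_one_def sum_product mult_single plus_list_def)

section \<open>The spaces Z and B, and the number of elements of Z\<close>

lemma function_subspace_Z_space: "function_subspace (Z_space \<A>)"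
  unfolding function_subspace_def
proof (intro conjI ballI allI)
  show "(\<lambda>_. 0) \<in> Z_space \<A>"
    by (simp add: Z_space_def os_prod_zero_def coord_space_def degree_one_mult os_ideal_def
        two_sided_ideal.zero)
next
  fix x y :: "(complex ^ 'a) set \<Rightarrow> 'b"
  assume "x \<in> Z_space \<A>" "y \<in> Z_space \<A>"
  moreover have "degree_one \<A> (\<lambda>H. x H + y H) = degree_one \<A> x + degree_one \<A> y"
    by (simp add: degree_one_def single_add sum.distrib)
  ultimately show "(\<lambda>H. x H + y H) \<in> Z_space \<A>"
    by (auto simp: Z_space_def os_prod_zero_def coord_space_def distrib_left intro: os_ideal_add)
next
  fix c and x :: "(complex ^ 'a) set \<Rightarrow> 'b"
  assume "x \<in> Z_space \<A>"
  moreover have "degree_one \<A> (sigma_elt \<A>) * degree_one \<A> (\<lambda>H. c * x H) =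
      Poly_Mapping.single [] c * (degree_one \<A> (sigma_elt \<A>) * degree_one \<A> x)"
    by (simp add: degree_one_mult sum_distrib_left single_Nil_mult mult.left_commute)
  ultimately show "(\<lambda>H. c * x H) \<in> Z_space \<A>"
    by (auto simp: Z_space_def os_prod_zero_def coord_space_def intro: os_ideal_scale)
qed

lemma function_subspace_B_space: "function_subspace (B_space \<A>)"
  unfolding function_subspace_def
proof (intro conjI ballI allI)
  show "(\<lambda>_. 0) \<in> B_space \<A>" unfolding B_space_def by (auto intro: exI[of _ 0])
next
  fix x y :: "(complex ^ 'a) set \<Rightarrow> 'b"
  assume "x \<in> B_space \<A>" "y \<in> B_space \<A>"
  then obtain c d where "x = (\<lambda>H. c * sigma_elt \<A> H)" "y = (\<lambda>H. d * sigma_elt \<A> H)"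
    unfolding B_space_def by blast
  then show "(\<lambda>H. x H + y H) \<in> B_space \<A>"
    unfolding B_space_def by (intro CollectI exI[of _ "c + d"]) (simp add: distrib_right)
next
  fix c and x :: "(complex ^ 'a) set \<Rightarrow> 'b"
  assume "x \<in> B_space \<A>"
  then obtain d where "x = (\<lambda>H. d * sigma_elt \<A> H)"
    unfolding B_space_def by blast
  then show "(\<lambda>H. c * x H) \<in> B_space \<A>"
    unfolding B_space_def by (intro CollectI exI[of _ "c * d"]) (simp add: mult.assoc)
qed

lemma B_space_subset_Z_space:
  assumes "finite \<A>"
  shows "B_space \<A> \<subseteq> Z_space \<A>"
proof -
  \<comment> \<open>The square of \<open>sigma_elt\<close> is the constant block on all of
    \<open>\<A>\<close> with coefficient 1.\<close>
  have "sigma_elt \<A> \<in> Z_space \<A>"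
    using os_ideal_constant_block[OF assms order_refl, of 1]
    by (simp add: Z_space_def coord_space_def os_prod_zero_def degree_one_mult sigma_elt_def)
  then show ?thesis
    unfolding B_space_def using function_subspace_scale[OF function_subspace_Z_space] by blast
qed

text \<open>A hyperplane of \<open>\<A>\<close> is a coordinate at which \<open>sigma_elt\<close>
  equals 1, so a multiple of it determines the scalar.\<close>

lemma card_B_space:
  assumes "\<A> \<noteq> {}"
  shows "card (B_space \<A> :: ((complex ^ 'n) set \<Rightarrow> 'f::field) set) = CARD('f)"
proof -
  have B: "B_space \<A> = range (\<lambda>(c::'f) H. c * sigma_elt \<A> H)"
    unfolding B_space_def by blast
  obtain H where "H \<in> \<A>" using assms by blast
  then have "inj (\<lambda>(c::'f) H. c * sigma_elt \<A> H)"
    by (intro injI) (auto simp: fun_eq_iff sigma_elt_def dest!: spec[of _ H])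
  then show ?thesis unfolding B by (rule card_image)
qed

lemma finite_coord_space:
  assumes "finite \<A>" "finite (UNIV :: 'f::zero set)"
  shows "finite (coord_space \<A> :: ('h \<Rightarrow> 'f) set)"
proof -
  have "finite {a :: 'h \<Rightarrow> 'f. \<forall>H. (H \<in> \<A> \<longrightarrow> a H \<in> UNIV) \<and> (H \<notin> \<A> \<longrightarrow> a H = 0)}"
    using assms by (rule finite_set_of_finite_funs)
  then show ?thesis by (simp add: coord_space_def)
qed

lemma card_Z_space:
  fixes \<A> :: "(complex ^ 'n) set set"
  assumes "finite \<A>" "\<A> \<noteq> {}" "CARD('f::field) > 1"
  shows "card (Z_space \<A> :: ((complex ^ 'n) set \<Rightarrow> 'f) set) =
    CARD('f) * CARD('f) ^ resonance_beta TYPE('f) \<A>"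
    and "finite (Z_space \<A> :: ((complex ^ 'n) set \<Rightarrow> 'f) set)"
proof -
  \<comment> \<open>Infinite types have \<open>CARD\<close> equal to 0, so
    \<open>CARD('f) > 1\<close> includes finiteness of the field.\<close>
  have "finite (UNIV :: 'f set)" using assms(3) by (intro card_ge_0_finite) simp
  then show fin: "finite (Z_space \<A> :: ((complex ^ 'n) set \<Rightarrow> 'f) set)"
    by (intro finite_subset[OF _ finite_coord_space[OF assms(1)]]) (auto simp: Z_space_def)
  show "card (Z_space \<A> :: ((complex ^ 'n) set \<Rightarrow> 'f) set) =
    CARD('f) * CARD('f) ^ resonance_beta TYPE('f) \<A>"
    using card_eq_power_quotient_dim[OF fin function_subspace_Z_space function_subspace_B_space
        B_space_subset_Z_space[OF assms(1)] assms(3)] card_B_space[OF assms(2), where ?'f = 'f]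
    unfolding resonance_beta_def by simp
qed

section \<open>Circuits of size three\<close>

lemma defining_form:
  assumes "central_arrangement \<A>" "H \<in> \<A>"
  shows "defining_form H \<noteq> 0" "ker_form (defining_form H) = H"
proof -
  have "\<exists>c. c \<noteq> 0 \<and> H = ker_form c" using assms unfolding central_arrangement_def by blast
  then have "defining_form H \<noteq> 0 \<and> H = ker_form (defining_form H)"
    unfolding defining_form_def by (rule someI_ex)
  then show "defining_form H \<noteq> 0" "ker_form (defining_form H) = H" by auto
qed

text \<open>The complex bilinear pairing underlying \<open>ker_form\<close>, as opposed to the
  real-valued inner product of the type.\<close>

abbreviation form_at :: "complex ^ 'n \<Rightarrow> complex ^ 'n \<Rightarrow> complex" where
  "form_at c x \<equiv> (\<Sum>i\<in>UNIV. c $ i * x $ i)"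

lemma form_at_linear:
  "form_at c (x + y) = form_at c x + form_at c y"
  "form_at c (x - y) = form_at c x - form_at c y"
  "form_at c (t *s x) = t * form_at c x"
  by (simp_all add: distrib_left right_diff_distrib sum.distrib sum_subtractf sum_distrib_left mult.left_commute)

lemma form_at_axis: "form_at c (axis i 1) = c $ i"
proof -
  have "form_at c (axis i 1) = (\<Sum>j\<in>UNIV. if i = j then c $ j else 0)"
    by (intro sum.cong) (auto simp: axis_def)
  then show ?thesis by simp
qed

lemma form_at_eqI:
  assumes "\<And>x. form_at c x = form_at d x"
  shows "c = d"
  using assms[of "axis _ 1"] by (simp add: form_at_axis vec_eq_iff)

lemma subspace_ker_form: "vec.subspace (ker_form c)"
  unfolding vec.subspace_def ker_form_def by (simp add: form_at_linear del: vector_add_component vector_smult_component)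

text \<open>A form that vanishes on the kernel of \<open>c\<close> is a multiple of
  \<open>c\<close>: split off from each x its component along a vector \<open>x0\<close> on which
  \<open>c\<close> takes the value 1. As \<open>d\<close> is nonzero, so is the factor.\<close>

lemma ker_form_subset_imp_eq:
  assumes "c \<noteq> 0" "d \<noteq> 0" "ker_form c \<subseteq> ker_form d"
  shows "ker_form c = ker_form d"
proof -
  obtain i where i: "c $ i \<noteq> 0" using assms(1) by (auto simp: vec_eq_iff)
  define x0 where "x0 = (1 / c $ i) *s axis i 1"
  have x0: "form_at c x0 = 1" unfolding x0_def form_at_linear form_at_axis using i by simp
  have eq: "form_at d x = form_at c x * form_at d x0" for x
  proof -
    have "x - form_at c x *s x0 \<in> ker_form c"
      unfolding ker_form_def mem_Collect_eq form_at_linear x0 by simp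
    then have "x - form_at c x *s x0 \<in> ker_form d" using assms(3) by blast
    then show ?thesis unfolding ker_form_def mem_Collect_eq form_at_linear by simp
  qed
  have "form_at d x0 \<noteq> 0"
  proof
    assume "form_at d x0 = 0"
    then have "form_at d x = form_at 0 x" for x using eq[of x] by simp
    then show False using form_at_eqI assms(2) by blast
  qed
  then have "form_at d x = 0 \<longleftrightarrow> form_at c x = 0" for x by (simp only: eq[of x] mult_eq_0_iff simp_thms)
  then show ?thesis unfolding ker_form_def by blast
qed

text \<open>Two different kernels of nonzero forms are not contained in one another. Applied in both
  orders, this yields a pair of vectors dual to \<open>c\<close> and \<open>d\<close>.\<close>

lemma dual_vector:
  assumes "c \<noteq> 0" "d \<noteq> 0" "ker_form c \<noteq> ker_form d"
  obtains x where "form_at c x = 0" "form_at d x = 1"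
proof -
  obtain y where y: "form_at c y = 0" "form_at d y \<noteq> 0"
    using ker_form_subset_imp_eq[OF assms(1,2)] assms(3) unfolding ker_form_def by blast
  have "form_at c ((1 / form_at d y) *s y) = 0" "form_at d ((1 / form_at d y) *s y) = 1"
    unfolding form_at_linear using y by auto
  then show ?thesis by (rule that)
qed

lemma independent_pair_forms:
  assumes "c \<noteq> 0" "d \<noteq> 0" "ker_form c \<noteq> ker_form d"
  shows "vec.independent {c, d}"
proof -
  have "c \<notin> vec.span {d}"
  proof
    assume "c \<in> vec.span {d}"
    then obtain t where t: "c = t *s d" by (auto simp: vec.span_singleton)
    then have "form_at c x = t * form_at d x" for x by (simp add: sum_distrib_left mult.assoc)
    then have "ker_form d \<subseteq> ker_form c" by (auto simp: ker_form_def)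
    then show False using ker_form_subset_imp_eq[OF assms(2,1)] assms(3) by blast
  qed
  then show ?thesis
    using assms(2) by (simp add: vec.independent_insert)
qed

text \<open>With \<open>x1\<close>, \<open>x2\<close> dual to \<open>c1\<close>, \<open>c2\<close>,
  subtracting from x its components along \<open>x1\<close> and \<open>x2\<close> leaves a vector in
  both kernels, hence in that of \<open>c3\<close>. So the coefficients of \<open>c3\<close> are its
  values at \<open>x1\<close> and \<open>x2\<close>.\<close>

lemma dependent_forms:
  assumes "c1 \<noteq> 0" "c2 \<noteq> 0" "ker_form c1 \<noteq> ker_form c2"
    and sub: "ker_form c1 \<inter> ker_form c2 \<subseteq> ker_form c3"
  shows "c3 \<in> vec.span {c1, c2}"
proof -
  obtain x2 where x2: "form_at c1 x2 = 0" "form_at c2 x2 = 1" by (rule dual_vector[OF assms(1-3)])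
  obtain x1 where x1: "form_at c2 x1 = 0" "form_at c1 x1 = 1"
    by (rule dual_vector[OF assms(2,1)]) (use assms(3) in auto)
  have "form_at c3 x = form_at (form_at c3 x1 *s c1 + form_at c3 x2 *s c2) x" for x
  proof -
    have "x - form_at c1 x *s x1 - form_at c2 x *s x2 \<in> ker_form c1 \<inter> ker_form c2"
      unfolding ker_form_def Int_iff mem_Collect_eq form_at_linear x1 x2 by simp
    then have "x - form_at c1 x *s x1 - form_at c2 x *s x2 \<in> ker_form c3" using sub by blast
    then have "form_at c3 x = form_at c3 x1 * form_at c1 x + form_at c3 x2 * form_at c2 x"
      unfolding ker_form_def mem_Collect_eq form_at_linear by (simp add: algebra_simps)
    then show ?thesis
      by (simp add: distrib_right sum.distrib mult.assoc flip: sum_distrib_left)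
  qed
  then have "c3 = form_at c3 x1 *s c1 + form_at c3 x2 *s c2" by (rule form_at_eqI)
  moreover have "form_at c3 x1 *s c1 + form_at c3 x2 *s c2 \<in> vec.span {c1, c2}"
    by (intro vec.span_add vec.span_scale vec.span_base) simp_all
  ultimately show ?thesis by (rule ssubst)
qed

text \<open>The third form vanishes on the common kernel of the first two, so the three are
  dependent; distinct hyperplanes have independent pairs of forms, so the dependence is
  minimal.\<close>

lemma circuit_of_pencil:
  assumes arr: "central_arrangement \<A>" and in_\<A>: "H1 \<in> \<A>" "H2 \<in> \<A>" "H3 \<in> \<A>"
    and "distinct [H1, H2, H3]" "H1 \<inter> H2 \<subseteq> H3"
  shows "circuit \<A> {H1, H2, H3}"
proof -
  note df = defining_form[OF arr]
  \<comment> \<open>Dependence is defined through the image set of forms, so distinct hyperplanes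
    must not collapse to the same form.\<close>
  have inj: "inj_on defining_form \<A>" using df(2) by (metis inj_onI)
  have pair: "\<not> dependent_hyperplanes {H, H'}" if "H \<in> \<A>" "H' \<in> \<A>" "H \<noteq> H'" for H H'
    using independent_pair_forms[of "defining_form H" "defining_form H'"] df that
    by (simp add: dependent_hyperplanes_def)
  have "defining_form H3 \<in> vec.span (defining_form ` {H1, H2, H3} - {defining_form H3})"
  proof -
    have "defining_form ` {H1, H2, H3} - {defining_form H3} = {defining_form H1, defining_form H2}"
      using assms inj by (auto dest: inj_onD)
    then show ?thesis using dependent_forms[of "defining_form H1" "defining_form H2"] df assms by simp
  qed
  then have "dependent_hyperplanes {H1, H2, H3}"
    unfolding dependent_hyperplanes_def vec.dependent_def by blast
  moreover have "\<not> dependent_hyperplanes T" if "T \<subset> {H1, H2, H3}" for T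
  proof -
    have "T \<subseteq> {H1, H2} \<or> T \<subseteq> {H1, H3} \<or> T \<subseteq> {H2, H3}" using that by blast
    then obtain H H' where "H \<in> \<A>" "H' \<in> \<A>" "H \<noteq> H'" "T \<subseteq> {H, H'}"
      using assms by auto
    then show ?thesis
      using pair[of H H'] vec.independent_mono[of "defining_form ` {H, H'}" "defining_form ` T"]
      unfolding dependent_hyperplanes_def by blast
  qed
  ultimately show ?thesis using in_\<A> by (auto simp: circuit_def)
qed

section \<open>Nets as colourings\<close>

text \<open>One function replaces the classes, and \<open>bij_betw\<close> says that each colour
  occurs exactly once on the flat, which absorbs the multiplicities and the base locus.\<close>

definition net_colouring ::
  "(complex ^ 'n) set set \<Rightarrow> nat \<Rightarrow> ((complex ^ 'n) set \<Rightarrow> nat) \<Rightarrow> bool" where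
  "net_colouring \<A> k \<rho> \<longleftrightarrow> k \<ge> 3 \<and> \<rho> ` \<A> = {1..k} \<and>
     (\<forall>H\<in>\<A>. \<forall>H'\<in>\<A>. \<rho> H \<noteq> \<rho> H' \<longrightarrow> H \<inter> H' \<in> codim2_flats \<A> \<and>
        bij_betw \<rho> (hyperplanes_through \<A> (H \<inter> H')) {1..k})"

text \<open>Positive integer multiplicities with sum 1 belong to a single hyperplane, so each class
  has exactly one member through a base flat.\<close>

lemma net_colouringE:
  assumes "net \<A> k cls" "finite \<A>"
  obtains \<rho> where "net_colouring \<A> k \<rho>" "\<forall>\<alpha>\<in>{1..k}. cls \<alpha> = {H \<in> \<A>. \<rho> H = \<alpha>}"
proof -
  obtain m \<X> where mn: "multinet \<A> k cls m \<X>"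
    and one: "\<And>X \<alpha>. X \<in> \<X> \<Longrightarrow> \<alpha> \<in> {1..k} \<Longrightarrow> (\<Sum>H\<in>cls \<alpha> \<inter> hyperplanes_through \<A> X. m H) = 1"
    using assms unfolding net_def by blast
  have k: "k \<ge> 3" and un: "(\<Union>\<alpha>\<in>{1..k}. cls \<alpha>) = \<A>" and disj: "disjoint_family_on cls {1..k}"
    and ne: "\<forall>\<alpha>\<in>{1..k}. cls \<alpha> \<noteq> {}" and m: "\<forall>H\<in>\<A>. m H > 0"
    and \<X>: "\<X> \<subseteq> codim2_flats \<A>"
    and meet: "\<forall>\<alpha>\<in>{1..k}. \<forall>\<beta>\<in>{1..k}. \<alpha> \<noteq> \<beta> \<longrightarrow> (\<forall>H\<in>cls \<alpha>. \<forall>H'\<in>cls \<beta>. H \<inter> H' \<in> \<X>)"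
    using mn unfolding multinet_def by - (elim conjE, assumption)+
  have "\<forall>H\<in>\<A>. \<exists>\<alpha>\<in>{1..k}. H \<in> cls \<alpha>" using un by blast
  then obtain \<rho> where \<rho>: "\<And>H. H \<in> \<A> \<Longrightarrow> \<rho> H \<in> {1..k} \<and> H \<in> cls (\<rho> H)" by metis
  have cls: "cls \<alpha> = {H \<in> \<A>. \<rho> H = \<alpha>}" if "\<alpha> \<in> {1..k}" for \<alpha>
  proof (intro subset_antisym subsetI)
    fix H assume H: "H \<in> cls \<alpha>"
    then have "H \<in> \<A>" using un that by blast
    then show "H \<in> {H \<in> \<A>. \<rho> H = \<alpha>}"
      using \<rho>[of H] disj H that unfolding disjoint_family_on_def by blast
  qed (use \<rho> in auto)
  have "net_colouring \<A> k \<rho>"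
    unfolding net_colouring_def
  proof (intro conjI ballI impI)
    show "k \<ge> 3" by (fact k)
    show "\<rho> ` \<A> = {1..k}" using \<rho> ne cls by fastforce
    fix H H' assume HH': "H \<in> \<A>" "H' \<in> \<A>" "\<rho> H \<noteq> \<rho> H'"
    then have X: "H \<inter> H' \<in> \<X>" using meet \<rho> by blast
    then show "H \<inter> H' \<in> codim2_flats \<A>" using \<X> by blast
    let ?S = "hyperplanes_through \<A> (H \<inter> H')"
    have "\<exists>!G. G \<in> ?S \<and> \<rho> G = \<alpha>" if \<alpha>: "\<alpha> \<in> {1..k}" for \<alpha>
    proof -
      let ?C = "cls \<alpha> \<inter> ?S"
      have sub: "?C \<subseteq> \<A>" by (auto simp: hyperplanes_through_def)
      then have fin: "finite ?C" using assms(2) finite_subset by blast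
      \<comment> \<open>Every multiplicity is at least 1, so the class has at most one hyperplane
        here; an empty class would give the sum 0.\<close>
      have "card ?C \<le> (\<Sum>G\<in>?C. m G)"
        using sum_mono[of ?C "\<lambda>_. 1" m] m sub by (force simp: Suc_le_eq)
      then have "card ?C \<le> 1" using one[OF X \<alpha>] by simp
      moreover have "?C \<noteq> {}" using one[OF X \<alpha>] by auto
      ultimately have "card ?C = 1" using fin by (simp add: le_Suc_eq)
      moreover have "?C = {G \<in> ?S. \<rho> G = \<alpha>}"
        using cls[OF \<alpha>] by (auto simp: hyperplanes_through_def)
      ultimately obtain G where "{G \<in> ?S. \<rho> G = \<alpha>} = {G}" by (metis card_1_singletonE)
      then have "K \<in> ?S \<and> \<rho> K = \<alpha> \<longleftrightarrow> K = G" for K by blast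
      then show ?thesis by simp
    qed
    note ex1 = this
    have "\<rho> ` ?S \<subseteq> {1..k}" using \<rho> by (auto simp: hyperplanes_through_def)
    then show "bij_betw \<rho> ?S {1..k}"
      unfolding bij_betw_def inj_on_def using ex1 by (metis (no_types, lifting) image_subset_iff imageI subsetI subset_antisym)
  qed
  then show ?thesis using cls that by blast
qed

text \<open>Both are subspaces of the same dimension. This later identifies the intersection of any
  two differently coloured hyperplanes through a base flat with that flat.\<close>

lemma flat_eqI:
  assumes "central_arrangement \<A>" "X \<in> codim2_flats \<A>" "Y \<in> codim2_flats \<A>" "X \<subseteq> Y"
  shows "X = Y"
proof -
  have sub: "vec.subspace Z" if Z: "Z \<in> codim2_flats \<A>" for Z
  proof -
    obtain \<B> where B: "\<B> \<subseteq> \<A>" "Z = \<Inter>\<B>" using Z by (auto simp: codim2_flats_def)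
    show ?thesis unfolding B(2)
    proof (rule vec.subspace_Inter, rule ballI)
      fix H assume "H \<in> \<B>"
      then show "vec.subspace H"
        using subspace_ker_form[of "defining_form H"] defining_form(2)[OF assms(1), of H] B(1) by auto
    qed
  qed
  have "vec.dim X = vec.dim Y" using assms(2,3) by (auto simp: codim2_flats_def)
  then show ?thesis
    using vec.subspace_dim_equal[OF sub sub, of X Y] assms by simp
qed

section \<open>The cocycles attached to a net\<close>

text \<open>Multiplication by some \<open>a\<close> other than 0 and 1 permutes the field, so it
  fixes the sum of all elements, which is therefore 0. Translation by 1 also permutes the field and
  adds \<open>CARD('f)\<close> to that sum.\<close>

lemma sum_UNIV_finite_field:
  assumes "CARD('f::field) > 2"
  shows "(\<Sum>x\<in>(UNIV :: 'f set). x) = 0" "of_nat (CARD('f)) = (0::'f)"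
proof -
  have fin: "finite (UNIV :: 'f set)" using assms by (intro card_ge_0_finite) simp
  have "\<exists>a::'f. a \<noteq> 0 \<and> a \<noteq> 1"
  proof (rule ccontr)
    assume "\<not> ?thesis"
    then have "(UNIV :: 'f set) \<subseteq> {0, 1}" by blast
    then have "CARD('f) \<le> card {0::'f, 1}" by (intro card_mono) auto
    then show False using assms by (simp add: card_insert_if)
  qed
  then obtain a :: 'f where a: "a \<noteq> 0" "a \<noteq> 1" by blast
  have "bij (\<lambda>x. a * x)"
    using a by (intro bijI' ) (auto intro: exI[of _ "_ / a"])
  then have "(\<Sum>x\<in>(UNIV :: 'f set). a * x) = (\<Sum>x\<in>UNIV. x)"
    by (rule sum.reindex_bij_betw)
  then have "(a - 1) * (\<Sum>x\<in>(UNIV :: 'f set). x) = 0"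
    by (simp add: left_diff_distrib flip: sum_distrib_left)
  then show "(\<Sum>x\<in>(UNIV :: 'f set). x) = 0" using a by simp
  have "bij (\<lambda>x::'f. x + 1)"
    by (intro bijI') (auto intro: exI[of _ "_ - 1"])
  then have "(\<Sum>x\<in>(UNIV :: 'f set). x + 1) = (\<Sum>x\<in>UNIV. x)"
    by (rule sum.reindex_bij_betw)
  then show "of_nat (CARD('f)) = (0::'f)" by (simp add: sum.distrib)
qed

definition net_cocycle :: "'h set \<Rightarrow> ('h \<Rightarrow> nat) \<Rightarrow> (nat \<Rightarrow> 'f::field) \<Rightarrow> 'h \<Rightarrow> 'f" where
  "net_cocycle \<A> \<rho> g H = (if H \<in> \<A> then g (\<rho> H) else 0)"

text \<open>The product is a sum over ordered pairs. Pairs of equal colour, \<open>E\<close>, are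
  grouped by colour into constant blocks; pairs of different colours, \<open>D\<close>, are grouped
  by their intersection into pencils.\<close>

lemma net_cocycle_in_Z_space:
  fixes g :: "nat \<Rightarrow> 'f::field"
  assumes arr: "central_arrangement \<A>" and col: "net_colouring \<A> k \<rho>"
    and g: "bij_betw g {1..k} UNIV"
  shows "net_cocycle \<A> \<rho> g \<in> Z_space \<A>"
proof -
  have fin: "finite \<A>" using arr by (simp add: central_arrangement_def)
  have k: "CARD('f) = k" using bij_betw_same_card[OF g] by simp
  have k3: "k \<ge> 3" and \<rho>: "\<rho> ` \<A> = {1..k}"
    and flat: "\<And>H H'. H \<in> \<A> \<Longrightarrow> H' \<in> \<A> \<Longrightarrow> \<rho> H \<noteq> \<rho> H' \<Longrightarrow> H \<inter> H' \<in> codim2_flats \<A>"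
    and bij: "\<And>H H'. H \<in> \<A> \<Longrightarrow> H' \<in> \<A> \<Longrightarrow> \<rho> H \<noteq> \<rho> H' \<Longrightarrow>
       bij_betw \<rho> (hyperplanes_through \<A> (H \<inter> H')) {1..k}"
    using col unfolding net_colouring_def by blast+
  let ?f = "\<lambda>(H, H'). Poly_Mapping.single [H, H'] (g (\<rho> H'))"
  define D where "D = {(H, H') \<in> \<A> \<times> \<A>. \<rho> H \<noteq> \<rho> H'}"
  define E where "E = {(H, H') \<in> \<A> \<times> \<A>. \<rho> H = \<rho> H'}"
  have finD: "finite D" and finE: "finite E"
    using fin by (auto intro: finite_subset[of _ "\<A> \<times> \<A>"] simp: D_def E_def)
  have "sum ?f E = (\<Sum>\<alpha>\<in>{1..k}. \<Sum>p\<in>{p \<in> E. \<rho> (fst p) = \<alpha>}. ?f p)"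
    using finE \<rho> by (intro sum.group[symmetric]) (auto simp: E_def)
  also have "\<dots> = (\<Sum>\<alpha>\<in>{1..k}. \<Sum>H\<in>{H \<in> \<A>. \<rho> H = \<alpha>}. \<Sum>H'\<in>{H \<in> \<A>. \<rho> H = \<alpha>}. Poly_Mapping.single [H, H'] (g \<alpha>))"
    unfolding sum.cartesian_product by (intro sum.cong) (auto simp: E_def)
  also have "\<dots> \<in> os_ideal \<A>"
    using fin by (intro os_ideal_sum os_ideal_constant_block) auto
  finally have E: "sum ?f E \<in> os_ideal \<A>" .
  have pencil: "sum ?f {p \<in> D. fst p \<inter> snd p = X} \<in> os_ideal \<A>" if "X \<in> (\<lambda>p. fst p \<inter> snd p) ` D" for X
  proof -
    obtain G G' where G: "G \<in> \<A>" "G' \<in> \<A>" "\<rho> G \<noteq> \<rho> G'" and X: "X = G \<inter> G'"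
      using \<open>X \<in> _\<close> by (auto simp: D_def)
    define S where "S = hyperplanes_through \<A> X"
    have S: "S \<subseteq> \<A>" by (auto simp: S_def hyperplanes_through_def)
    have finS: "finite S" using S fin finite_subset by blast
    have \<rho>S: "bij_betw \<rho> S {1..k}" using bij[OF G] by (simp add: S_def X)
    have meet: "H \<inter> H' = X" if "H \<in> S" "H' \<in> S" "\<rho> H \<noteq> \<rho> H'" for H H'
      using flat_eqI[OF arr, of X "H \<inter> H'"] flat[OF G] flat[of H H'] that S
      by (auto simp: S_def hyperplanes_through_def X)
    have neq: "\<rho> H \<noteq> \<rho> H'" if "H \<in> S" "H' \<in> S" "H \<noteq> H'" for H H'
      using \<rho>S that by (auto simp: bij_betw_def dest: inj_onD)
    \<comment> \<open>Colours are distinct on \<open>S\<close>, so these are all its off-diagonal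
      pairs. Adding the diagonal costs only squares, and the full square is covered by
      \<open>os_ideal_pencil\<close>.\<close>
    have "{p \<in> D. fst p \<inter> snd p = X} = S \<times> S - (\<lambda>H. (H, H)) ` S"
    proof (intro subset_antisym subsetI)
      fix p assume "p \<in> {p \<in> D. fst p \<inter> snd p = X}"
      then show "p \<in> S \<times> S - (\<lambda>H. (H, H)) ` S" by (auto simp: D_def S_def hyperplanes_through_def)
    next
      fix p assume "p \<in> S \<times> S - (\<lambda>H. (H, H)) ` S"
      then obtain H H' where "p = (H, H')" "H \<in> S" "H' \<in> S" "H \<noteq> H'" by auto
      then show "p \<in> {p \<in> D. fst p \<inter> snd p = X}" using meet neq S by (auto simp: D_def)
    qed
    then have "sum ?f {p \<in> D. fst p \<inter> snd p = X} = sum ?f (S \<times> S) - sum ?f ((\<lambda>H. (H, H)) ` S)"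
      using finS by (auto intro: sum_diff)
    also have "sum ?f ((\<lambda>H. (H, H)) ` S) \<in> os_ideal \<A>"
      using S by (intro os_ideal_sum) (auto intro: os_ideal_square)
    moreover have "sum ?f (S \<times> S) \<in> os_ideal \<A>"
      unfolding sum.cartesian_product[symmetric]
    proof (rule os_ideal_pencil[OF S])
      fix H1 H2 H3 assume H: "H1 \<in> S" "H2 \<in> S" "H3 \<in> S" "distinct [H1, H2, H3]"
      then have "H1 \<inter> H2 = X" using meet neq by auto
      then show "circuit \<A> {H1, H2, H3}"
        using H S by (intro circuit_of_pencil[OF arr]) (auto simp: S_def hyperplanes_through_def)
    next
      have "card S = k" using bij_betw_same_card[OF \<rho>S] by simp
      then show "of_nat (card S) = (0::'f)" using sum_UNIV_finite_field(2)[where ?'f = 'f] k k3 by simp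
    next
      \<comment> \<open>Along the flat the cocycle takes every field element exactly once.\<close>
      have "bij_betw (\<lambda>H. g (\<rho> H)) S UNIV"
        using bij_betw_trans[OF \<rho>S g] by (simp add: comp_def)
      then have "(\<Sum>H\<in>S. g (\<rho> H)) = (\<Sum>x\<in>UNIV. x)" by (rule sum.reindex_bij_betw)
      then show "(\<Sum>H\<in>S. g (\<rho> H)) = 0" using sum_UNIV_finite_field(1)[where ?'f = 'f] k k3 by simp
    qed
    ultimately show ?thesis by (auto intro: os_ideal_diff)
  qed
  have "sum ?f D = (\<Sum>X\<in>(\<lambda>p. fst p \<inter> snd p) ` D. sum ?f {p \<in> D. fst p \<inter> snd p = X})"
    using finD by (rule sum.image_gen)
  also have "\<dots> \<in> os_ideal \<A>" by (intro os_ideal_sum pencil)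
  finally have D: "sum ?f D \<in> os_ideal \<A>" .
  have "degree_one \<A> (sigma_elt \<A>) * degree_one \<A> (net_cocycle \<A> \<rho> g) = sum ?f (\<A> \<times> \<A>)"
    by (simp add: degree_one_mult sigma_elt_def net_cocycle_def sum.cartesian_product[symmetric])
  also have "\<A> \<times> \<A> = D \<union> E" by (auto simp: D_def E_def)
  also have "sum ?f (D \<union> E) = sum ?f D + sum ?f E"
    using finD finE by (intro sum.union_disjoint) (auto simp: D_def E_def)
  also have "\<dots> \<in> os_ideal \<A>" using D E by (rule os_ideal_add)
  finally have "os_prod_zero \<A> (sigma_elt \<A>) (net_cocycle \<A> \<rho> g)" by (simp only: os_prod_zero_def)
  moreover have "net_cocycle \<A> \<rho> g \<in> coord_space \<A>"
    by (simp add: coord_space_def net_cocycle_def)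
  ultimately show ?thesis by (simp add: Z_space_def)
qed

text \<open>Elements of \<open>B_space\<close> are constant on \<open>\<A>\<close>, while
  \<open>g\<close> separates colours 1 and 2.\<close>

lemma net_cocycle_notin_B_space:
  fixes g :: "nat \<Rightarrow> 'f::field"
  assumes "net_colouring \<A> k \<rho>" "bij_betw g {1..k} UNIV"
  shows "net_cocycle \<A> \<rho> g \<notin> B_space \<A>"
proof
  have k: "k \<ge> 3" and \<rho>: "\<rho> ` \<A> = {1..k}" using assms(1) by (auto simp: net_colouring_def)
  have "1 \<in> \<rho> ` \<A>" "2 \<in> \<rho> ` \<A>" using k \<rho> by auto
  then obtain H1 H2 where H: "H1 \<in> \<A>" "H2 \<in> \<A>" "\<rho> H1 = 1" "\<rho> H2 = 2" by auto
  assume "net_cocycle \<A> \<rho> g \<in> B_space \<A>"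
  then obtain c where c: "net_cocycle \<A> \<rho> g = (\<lambda>H. c * sigma_elt \<A> H)"
    unfolding B_space_def by blast
  have "g 1 = g 2" using fun_cong[OF c, of H1] fun_cong[OF c, of H2] H by (simp add: net_cocycle_def sigma_elt_def)
  then show False using assms(2) k by (auto simp: bij_betw_def dest!: inj_onD[of g _ 1 2])
qed

section \<open>Recovering the component from a cocycle\<close>

text \<open>Unlike the definition, which singles out class 1, this description is symmetric in the
  colours and hence invariant under relabelling.\<close>

lemma net_component_colouring:
  fixes \<A> :: "(complex ^ 'n) set set"
  assumes "\<forall>\<alpha>\<in>{1..k}. cls \<alpha> = {H \<in> \<A>. \<rho> H = \<alpha>}" "\<rho> ` \<A> = {1..k}" "k \<ge> 1"
  shows "net_component k cls =
    {\<lambda>H. if H \<in> \<A> then d (\<rho> H) else 0 | d. (\<Sum>\<alpha>\<in>{1..k}. d \<alpha>) = 0}"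
proof -
  have split: "{1..k} = insert 1 {2..k}" using assms(3) by auto
  have form: "(\<Sum>\<alpha>=2..k. c \<alpha> * (indicator (cls \<alpha>) H - indicator (cls 1) H)) =
      (if H \<in> \<A> then (if \<rho> H = 1 then - (\<Sum>\<alpha>=2..k. c \<alpha>) else c (\<rho> H)) else 0)"
    for c :: "nat \<Rightarrow> complex" and H
  proof -
    have "(\<Sum>\<alpha>=2..k. c \<alpha> * (indicator (cls \<alpha>) H - indicator (cls 1) H)) =
        (\<Sum>\<alpha>=2..k. if H \<in> \<A> then (if \<rho> H = \<alpha> then c \<alpha> else 0) - (if \<rho> H = 1 then c \<alpha> else 0) else 0)"
      using assms(1,3) by (intro sum.cong) (auto simp: indicator_def)
    also have "\<dots> = (if H \<in> \<A> then (if \<rho> H \<in> {2..k} then c (\<rho> H) else 0) -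
        (if \<rho> H = 1 then (\<Sum>\<alpha>=2..k. c \<alpha>) else 0) else 0)"
      by (simp add: sum_subtractf)
    also have "\<dots> = (if H \<in> \<A> then (if \<rho> H = 1 then - (\<Sum>\<alpha>=2..k. c \<alpha>) else c (\<rho> H)) else 0)"
      using assms(2) split by fastforce
    finally show ?thesis .
  qed
  show ?thesis
  proof (intro subset_antisym subsetI)
    fix a assume "a \<in> net_component k cls"
    then obtain c where a: "a = (\<lambda>H. if H \<in> \<A> then (if \<rho> H = 1 then - (\<Sum>\<alpha>=2..k. c \<alpha>) else c (\<rho> H)) else 0)"
      unfolding net_component_def form by blast
    \<comment> \<open>Class 1 receives minus the sum of the other coefficients, so the values of
      \<open>d\<close> add up to 0.\<close>
    define d where "d \<alpha> = (if \<alpha> = 1 then - (\<Sum>\<alpha>=2..k. c \<alpha>) else c \<alpha>)" for \<alpha>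
    have "(\<Sum>\<alpha>=2..k. d \<alpha>) = (\<Sum>\<alpha>=2..k. c \<alpha>)" by (intro sum.cong) (auto simp: d_def)
    then have "(\<Sum>\<alpha>\<in>{1..k}. d \<alpha>) = 0" unfolding split by (simp add: d_def)
    moreover have "a = (\<lambda>H. if H \<in> \<A> then d (\<rho> H) else 0)" unfolding a by (simp add: d_def fun_eq_iff)
    ultimately show "a \<in> {\<lambda>H. if H \<in> \<A> then d (\<rho> H) else 0 | d. (\<Sum>\<alpha>\<in>{1..k}. d \<alpha>) = 0}" by blast
  next
    fix a assume "a \<in> {\<lambda>H. if H \<in> \<A> then d (\<rho> H) else (0::complex) | d. (\<Sum>\<alpha>\<in>{1..k}. d \<alpha>) = 0}"
    then obtain d where a: "a = (\<lambda>H. if H \<in> \<A> then d (\<rho> H) else 0)" and d: "(\<Sum>\<alpha>\<in>{1..k}. d \<alpha>) = 0" by blast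
    have "d 1 = - (\<Sum>\<alpha>=2..k. d \<alpha>)" using d unfolding split by (simp add: eq_neg_iff_add_eq_0)
    then show "a \<in> net_component k cls"
      unfolding net_component_def form a by (intro CollectI exI[of _ d]) (auto simp: fun_eq_iff)
  qed
qed

text \<open>Equal cocycles have equal level sets, so the two colourings differ by the permutation
  \<open>\<pi>\<close> of colours, which preserves the condition of sum zero. The reverse inclusion
  follows by exchanging the roles.\<close>

lemma net_component_eqI:
  fixes \<A> :: "(complex ^ 'n) set set" and g h :: "nat \<Rightarrow> 'f::field"
  assumes cls: "\<forall>\<alpha>\<in>{1..k}. cls \<alpha> = {H \<in> \<A>. \<rho> H = \<alpha>}" "\<rho> ` \<A> = {1..k}"
    and cls': "\<forall>\<alpha>\<in>{1..k}. cls' \<alpha> = {H \<in> \<A>. \<rho>' H = \<alpha>}" "\<rho>' ` \<A> = {1..k}"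
    and k: "k \<ge> 1" and g: "bij_betw g {1..k} UNIV" and h: "bij_betw h {1..k} UNIV"
    and eq: "net_cocycle \<A> \<rho> g = net_cocycle \<A> \<rho>' h"
  shows "net_component k cls \<subseteq> net_component k cls'"
proof
  fix a assume "a \<in> net_component k cls"
  then obtain d where a: "a = (\<lambda>H. if H \<in> \<A> then d (\<rho> H) else 0)" and d: "(\<Sum>\<alpha>\<in>{1..k}. d \<alpha>) = 0"
    unfolding net_component_colouring[OF cls k] by blast
  define \<pi> where "\<pi> = (\<lambda>\<alpha>. the_inv_into {1..k} g (h \<alpha>))"
  have \<pi>: "bij_betw \<pi> {1..k} {1..k}"
    unfolding \<pi>_def using bij_betw_trans[OF h bij_betw_the_inv_into[OF g]] by (simp add: comp_def)
  have "\<rho> H = \<pi> (\<rho>' H)" if "H \<in> \<A>" for H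
  proof -
    have "g (\<rho> H) = h (\<rho>' H)" using fun_cong[OF eq, of H] that by (simp add: net_cocycle_def)
    then show ?thesis
      using g cls(2) that by (metis \<pi>_def bij_betw_def imageI the_inv_into_f_f)
  qed
  then have "a = (\<lambda>H. if H \<in> \<A> then (d \<circ> \<pi>) (\<rho>' H) else 0)" unfolding a by auto
  moreover have "(\<Sum>\<alpha>\<in>{1..k}. (d \<circ> \<pi>) \<alpha>) = 0"
    using d sum.reindex_bij_betw[OF \<pi>, of d] by simp
  ultimately show "a \<in> net_component k cls'"
    unfolding net_component_colouring[OF cls' k] by blast
qed

section \<open>The bound\<close>

text \<open>Pairs of a component and a bijection onto the field inject into the complement of
  \<open>B_space\<close> in \<open>Z_space\<close>. Finiteness is asserted too, because
  \<open>card\<close> of an infinite set is 0.\<close>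

lemma Ess_bound:
  fixes \<A> :: "(complex ^ 'n) set set"
  assumes arr: "central_arrangement \<A>" and k: "CARD('f::field) = k" "k \<ge> 3"
  shows "finite (Ess k \<A>) \<and>
    real (card (Ess k \<A>)) \<le> (real k ^ resonance_beta TYPE('f) \<A> - 1) / fact (k - 1)"
proof (cases "Ess k \<A> = {}")
  \<comment> \<open>The left side is 0 and the right side nonnegative. In the other case
    \<open>\<A>\<close> is nonempty, as \<open>card_B_space\<close> demands.\<close>
  case True
  then show ?thesis using k by simp
next
  case False
  have fin: "finite \<A>" using arr by (simp add: central_arrangement_def)
  let ?Z = "Z_space \<A> :: ((complex ^ 'n) set \<Rightarrow> 'f) set"
  let ?B = "B_space \<A> :: ((complex ^ 'n) set \<Rightarrow> 'f) set"
  have finF: "finite (UNIV :: 'f set)" using k by (intro card_ge_0_finite) simp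
  \<comment> \<open>Extensional functions, so that each of the \<open>fact k\<close> bijections is
    counted once.\<close>
  define \<G> where "\<G> = {g \<in> {1..k} \<rightarrow>\<^sub>E (UNIV :: 'f set). bij_betw g {1..k} UNIV}"
  have "\<forall>C\<in>Ess k \<A>. \<exists>\<rho> cls. net_colouring \<A> k \<rho> \<and>
      (\<forall>\<alpha>\<in>{1..k}. cls \<alpha> = {H \<in> \<A>. \<rho> H = \<alpha>}) \<and> C = net_component k cls"
  proof
    fix C assume "C \<in> Ess k \<A>"
    then obtain cls where net: "net \<A> k cls" and C: "C = net_component k cls" by (auto simp: Ess_def)
    obtain \<rho> where "net_colouring \<A> k \<rho>" "\<forall>\<alpha>\<in>{1..k}. cls \<alpha> = {H \<in> \<A>. \<rho> H = \<alpha>}"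
      using net_colouringE[OF net fin] by blast
    with C show "\<exists>\<rho> cls. net_colouring \<A> k \<rho> \<and>
      (\<forall>\<alpha>\<in>{1..k}. cls \<alpha> = {H \<in> \<A>. \<rho> H = \<alpha>}) \<and> C = net_component k cls" by blast
  qed
  from bchoice[OF this] obtain \<rho> where "\<forall>C\<in>Ess k \<A>. \<exists>cls. net_colouring \<A> k (\<rho> C) \<and>
      (\<forall>\<alpha>\<in>{1..k}. cls \<alpha> = {H \<in> \<A>. \<rho> C H = \<alpha>}) \<and> C = net_component k cls" ..
  from bchoice[OF this] obtain cls where all: "\<forall>C\<in>Ess k \<A>. net_colouring \<A> k (\<rho> C) \<and>
      (\<forall>\<alpha>\<in>{1..k}. cls C \<alpha> = {H \<in> \<A>. \<rho> C H = \<alpha>}) \<and> C = net_component k (cls C)" ..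
  have col: "net_colouring \<A> k (\<rho> C)"
    and cls: "\<forall>\<alpha>\<in>{1..k}. cls C \<alpha> = {H \<in> \<A>. \<rho> C H = \<alpha>}"
    and comp: "C = net_component k (cls C)" if "C \<in> Ess k \<A>" for C
    using bspec[OF all that] by - (elim conjE, assumption)+
  have surj: "\<rho> C ` \<A> = {1..k}" if "C \<in> Ess k \<A>" for C
    using col[OF that] by (simp add: net_colouring_def)
  have "\<A> \<noteq> {}" using False surj k by fastforce
  let ?\<phi> = "\<lambda>(C, g). net_cocycle \<A> (\<rho> C) g"
  have inj: "inj_on ?\<phi> (Ess k \<A> \<times> \<G>)"
  proof (rule inj_onI)
    fix p q assume pq: "p \<in> Ess k \<A> \<times> \<G>" "q \<in> Ess k \<A> \<times> \<G>" "?\<phi> p = ?\<phi> q"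
    obtain C g C' g' where [simp]: "p = (C, g)" "q = (C', g')" by (cases p, cases q)
    have C: "C \<in> Ess k \<A>" and C': "C' \<in> Ess k \<A>" and g: "bij_betw g {1..k} UNIV" and g': "bij_betw g' {1..k} UNIV"
      and eq: "net_cocycle \<A> (\<rho> C) g = net_cocycle \<A> (\<rho> C') g'" using pq by (auto simp: \<G>_def)
    have k1: "k \<ge> 1" using k by simp
    have "net_component k (cls C) = net_component k (cls C')"
      using net_component_eqI[OF cls[OF C] surj[OF C] cls[OF C'] surj[OF C'] k1 g g' eq]
        net_component_eqI[OF cls[OF C'] surj[OF C'] cls[OF C] surj[OF C] k1 g' g eq[symmetric]] by blast
    then have CC: "C = C'" using comp[OF C] comp[OF C'] by simp
    \<comment> \<open>With the same component the same chosen colouring is used, and every colour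
      occurs in it.\<close>
    have "g \<alpha> = g' \<alpha>" if "\<alpha> \<in> {1..k}" for \<alpha>
    proof -
      obtain H where "H \<in> \<A>" "\<rho> C H = \<alpha>" using \<open>\<alpha> \<in> _\<close> surj[OF C] by (metis imageE)
      then show ?thesis using fun_cong[OF eq, of H] CC by (simp add: net_cocycle_def)
    qed
    moreover have "g \<in> {1..k} \<rightarrow>\<^sub>E UNIV" "g' \<in> {1..k} \<rightarrow>\<^sub>E UNIV" using pq(1,2) by (simp_all add: \<G>_def)
    ultimately have "g = g'" by (intro PiE_ext) blast+
    with CC show "p = q" by simp
  qed
  have sub: "?\<phi> ` (Ess k \<A> \<times> \<G>) \<subseteq> ?Z - ?B"
    using net_cocycle_in_Z_space[OF arr col] net_cocycle_notin_B_space[OF col] by (auto simp: \<G>_def)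
  \<comment> \<open>Between finite sets of equal size injections are bijections, so the count of
    injections gives the size of \<open>\<G>\<close>.\<close>
  have "g ` {1..k} = UNIV" if "inj_on g {1..k}" for g :: "nat \<Rightarrow> 'f"
    using finF that k(1) by (intro card_subset_eq) (simp_all add: card_image)
  then have "\<G> = {g \<in> {1..k} \<rightarrow>\<^sub>E (UNIV :: 'f set). inj_on g {1..k}}"
    by (auto simp: \<G>_def bij_betw_def)
  then have card_\<G>: "card \<G> = fact k"
    using card_inj_on_subset_funcset[of "{1..k}" "UNIV :: 'f set" "{1..k}"] finF k(1)
    by (simp add: fact_prod_rev lessThan_atLeast0)
  have BZ: "?B \<subseteq> ?Z" by (rule B_space_subset_Z_space[OF fin])
  have F1: "CARD('f) > 1" using k by simp
  note Z = card_Z_space[OF fin \<open>\<A> \<noteq> {}\<close> F1]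
  have finP: "finite (Ess k \<A> \<times> \<G>)" using inj_on_finite[OF inj sub] Z(2) by simp
  have "\<G> \<noteq> {}" using card_\<G> by (metis card.empty fact_nonzero)
  then have finE: "finite (Ess k \<A>)" using finP by (auto simp: finite_cartesian_product_iff)
  have "card (Ess k \<A>) * fact k \<le> card (?Z - ?B)"
    using card_inj_on_le[OF inj sub] Z(2) by (simp add: card_cartesian_product card_\<G>)
  also have "\<dots> = k * k ^ resonance_beta TYPE('f) \<A> - k"
    using Z BZ k card_B_space[OF \<open>\<A> \<noteq> {}\<close>, where ?'f = 'f] finite_subset[OF BZ Z(2)]
    by (simp add: card_Diff_subset)
  finally have "card (Ess k \<A>) * fact k \<le> k * (k ^ resonance_beta TYPE('f) \<A> - 1)"
    by (simp add: right_diff_distrib')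
  \<comment> \<open>The factor \<open>k\<close> of \<open>fact k\<close> cancels against the common
    factor \<open>k\<close> on the right.\<close>
  moreover have "fact k = k * (fact (k - 1) :: nat)" using k by (simp add: fact_reduce)
  ultimately have "k * (card (Ess k \<A>) * fact (k - 1)) \<le> k * (k ^ resonance_beta TYPE('f) \<A> - 1)"
    by (simp add: mult.left_commute)
  then have "card (Ess k \<A>) * fact (k - 1) \<le> k ^ resonance_beta TYPE('f) \<A> - 1" using k by simp
  then have "real (card (Ess k \<A>) * fact (k - 1)) \<le> real (k ^ resonance_beta TYPE('f) \<A> - 1)"
    by (rule of_nat_mono)
  then have "real (card (Ess k \<A>)) * fact (k - 1) \<le> real k ^ resonance_beta TYPE('f) \<A> - 1"
    using k by (simp add: of_nat_diff)
  then show ?thesis using finE by (simp add: pos_le_divide_eq)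
qed

section \<open>Nets of different sizes do not coexist\<close>

lemma net_colouring_unique_size:
  assumes j: "net_colouring \<A> j \<rho>" and k: "net_colouring \<A> k \<psi>"
  shows "j = k"
proof (rule ccontr)
  assume "j \<noteq> k"
  have same: "\<rho> H = \<rho> H' \<or> \<psi> H = \<psi> H'" if H: "H \<in> \<A>" "H' \<in> \<A>" for H H'
  proof (rule ccontr)
    assume "\<not> ?thesis"
    then have "bij_betw \<rho> (hyperplanes_through \<A> (H \<inter> H')) {1..j}"
      "bij_betw \<psi> (hyperplanes_through \<A> (H \<inter> H')) {1..k}"
      using j k H unfolding net_colouring_def by blast+
    then show False using \<open>j \<noteq> k\<close> by (auto dest!: bij_betw_same_card)
  qed
  have two: "\<exists>H\<in>\<A>. \<exists>H'\<in>\<A>. \<theta> H \<noteq> \<theta> H'" if "net_colouring \<A> i \<theta>" for i \<theta>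
  proof -
    have "1 \<in> \<theta> ` \<A>" "2 \<in> \<theta> ` \<A>" using that by (auto simp: net_colouring_def)
    then show ?thesis by (metis imageE one_eq_numeral_iff semiring_norm(85))
  qed
  obtain H H' where H: "H \<in> \<A>" "H' \<in> \<A>" "\<rho> H \<noteq> \<rho> H'" using two[OF j] by blast
  obtain G G' where "G \<in> \<A>" "G' \<in> \<A>" "\<psi> G \<noteq> \<psi> G'" using two[OF k] by blast
  \<comment> \<open>By \<open>same\<close>, \<open>K\<close> has the \<open>\<rho>\<close>-colour of
    \<open>H\<close>, and \<open>H'\<close> the \<open>\<psi>\<close>-colour of \<open>H\<close>; so
    \<open>K\<close> and \<open>H'\<close> differ in both colourings.\<close>
  then obtain K where "K \<in> \<A>" "\<psi> K \<noteq> \<psi> H" by metis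
  then show False using same[of H H'] same[of K H] same[of K H'] H by metis
qed

text \<open>The type \<open>'f\<close> models the field with \<open>k\<close> elements; for a given
  \<open>'f\<close> the implication has content for at most one of the two values of
  \<open>k\<close>.\<close>

theorem theorem1p5:
  fixes \<A> :: "(complex ^ 'n) set set"
  assumes "central_arrangement \<A>"
  shows "(\<forall>k\<in>{3, 4}. CARD('f::field) = k \<longrightarrow>
           finite (Ess k \<A>) \<and>
           real (card (Ess k \<A>)) \<le> (real k ^ resonance_beta TYPE('f) \<A> - 1) / fact (k - 1)) \<and>
         \<not> (Ess 3 \<A> \<noteq> {} \<and> Ess 4 \<A> \<noteq> {})"
proof (intro conjI ballI impI notI)
  fix k :: nat assume k: "k \<in> {3, 4}" "CARD('f) = k"
  have "k \<ge> 3" using k(1) by auto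
  note Ess_bound[OF assms k(2) this]
  then show "finite (Ess k \<A>)"
    and "real (card (Ess k \<A>)) \<le> (real k ^ resonance_beta TYPE('f) \<A> - 1) / fact (k - 1)"
    by auto
next
  have fin: "finite \<A>" using assms by (simp add: central_arrangement_def)
  assume "Ess 3 \<A> \<noteq> {} \<and> Ess 4 \<A> \<noteq> {}"
  then obtain cls cls' where "net \<A> 3 cls" "net \<A> 4 cls'" by (auto simp: Ess_def)
  then obtain \<rho> \<psi> where "net_colouring \<A> 3 \<rho>" "net_colouring \<A> 4 \<psi>"
    using net_colouringE[OF _ fin] by metis
  then show False using net_colouring_unique_size by fastforce
qed

end
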